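(* The following are equivalent: (a) $(\mathcal{P}(\omega),\subseteq)$ has the weak Freese-Nation property; (b) $(\mathcal{P}(\omega),\subseteq^* )$ has the weak Freese-Nation property; (c) $(\mathcal{P}(\omega)/\mathrm{fin},\subseteq^* )$ has the weak Freese-Nation property; (d) $({}^{\omega}\omega,\leq)$ has the weak Freese-Nation property; (e) $({}^{\omega}\omega,\leq^* )$ has the weak Freese-Nation property; (f) $({}^{\omega}\mathbb{R},\leq)$ has the weak Freese-Nation property.
   Context: A quasi-ordering $(P,\leq)$ has the weak Freese-Nation property if there is a mapping $f:P\to[P]^{\leq\aleph_0}$ (assigning to each element of $P$ a countable subset of $P$) such that for all $p,q\in P$ with $p\leq q$ there is $r\in f(p)\cap f(q)$ with $p\leq r\leq q$. For $a,b\subseteq\omega$, $a\subseteq^* b$ means that $a\setminus b$ is finite; $\mathcal{P}(\omega)/\mathrm{fin}$ is the quotient of $\mathcal{P}(\omega)$ by the ideal of finite sets, partially ordered by the order induced by $\subseteq^*$. For functions $f,g$ on $\omega$, $f\leq g$ means $f(n)\leq g(n)$ for all $n\in\omega$, and $f\leq^* g$ means $f(n)\leq g(n)$ for all but finitely many $n\in\omega$. ${}^{\omega}X$ denotes the set of all functions from $\omega$ to $X$. *)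

theory Defs
  imports Complex_Main "HOL-Library.Countable_Set" "HOL-Library.FuncSet"
begin

text \<open>The definition only makes sense for quasi-orderings; that all six relations it is applied to
  are quasi-orderings is checked at the end of this theory.\<close>

definition weak_Freese_Nation :: "'a set \<Rightarrow> ('a \<Rightarrow> 'a \<Rightarrow> bool) \<Rightarrow> bool" where
  "weak_Freese_Nation P le \<longleftrightarrow>
     (\<exists>f \<in> P \<rightarrow> {C. C \<subseteq> P \<and> countable C}.
        \<forall>p \<in> P. \<forall>q \<in> P. le p q \<longrightarrow> (\<exists>r \<in> f p \<inter> f q. le p r \<and> le r q))"

definition almost_subset :: "nat set \<Rightarrow> nat set \<Rightarrow> bool"  (infix \<open>\<subseteq>\<^sup>*\<close> 50) where
  "a \<subseteq>\<^sup>* b \<longleftrightarrow> finite (a - b)"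

definition eq_mod_fin :: "(nat set \<times> nat set) set" where
  "eq_mod_fin = {(a, b). finite ((a - b) \<union> (b - a))}"

definition Pow_mod_fin :: "nat set set set" where
  "Pow_mod_fin = UNIV // eq_mod_fin"

definition le_mod_fin :: "nat set set \<Rightarrow> nat set set \<Rightarrow> bool" where
  "le_mod_fin X Y \<longleftrightarrow> (\<exists>a \<in> X. \<exists>b \<in> Y. a \<subseteq>\<^sup>* b)"

definition eventually_le :: "(nat \<Rightarrow> nat) \<Rightarrow> (nat \<Rightarrow> nat) \<Rightarrow> bool"  (infix \<open>\<le>\<^sup>*\<close> 50) where
  "f \<le>\<^sup>* g \<longleftrightarrow> finite {n. \<not> f n \<le> g n}"

lemma almost_subset_refl: "a \<subseteq>\<^sup>* a"
  by (simp add: almost_subset_def)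

lemma almost_subset_trans: "a \<subseteq>\<^sup>* b \<Longrightarrow> b \<subseteq>\<^sup>* c \<Longrightarrow> a \<subseteq>\<^sup>* c"
  unfolding almost_subset_def by (rule finite_subset [of _ "(a - b) \<union> (b - c)"]) auto

lemma eq_mod_fin_iff: "(a, b) \<in> eq_mod_fin \<longleftrightarrow> a \<subseteq>\<^sup>* b \<and> b \<subseteq>\<^sup>* a"
  by (simp add: eq_mod_fin_def almost_subset_def)

lemma equiv_eq_mod_fin: "equiv UNIV eq_mod_fin"
proof (rule equivI)
  show "refl eq_mod_fin"
    by (simp add: refl_on_def eq_mod_fin_iff almost_subset_refl)
  show "sym eq_mod_fin"
    by (simp add: sym_def eq_mod_fin_iff)
  show "trans eq_mod_fin"
    unfolding trans_def eq_mod_fin_iff by (blast intro: almost_subset_trans)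
qed auto

lemma le_mod_fin_class:
  "le_mod_fin (eq_mod_fin `` {a}) (eq_mod_fin `` {b}) \<longleftrightarrow> a \<subseteq>\<^sup>* b"
proof
  assume "le_mod_fin (eq_mod_fin `` {a}) (eq_mod_fin `` {b})"
  then obtain a' b' where "a \<subseteq>\<^sup>* a'" "a' \<subseteq>\<^sup>* b'" "b' \<subseteq>\<^sup>* b"
    by (auto simp: le_mod_fin_def eq_mod_fin_iff)
  then show "a \<subseteq>\<^sup>* b"
    by (blast intro: almost_subset_trans)
next
  assume "a \<subseteq>\<^sup>* b"
  then show "le_mod_fin (eq_mod_fin `` {a}) (eq_mod_fin `` {b})"
    unfolding le_mod_fin_def by (force simp: eq_mod_fin_iff almost_subset_refl)
qed

lemma quasi_order_subset:
  "reflp_on UNIV ((\<subseteq>) :: nat set \<Rightarrow> nat set \<Rightarrow> bool)"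
  "transp_on UNIV ((\<subseteq>) :: nat set \<Rightarrow> nat set \<Rightarrow> bool)"
  by (auto simp: reflp_on_def transp_on_def)

lemma quasi_order_almost_subset: "reflp_on UNIV (\<subseteq>\<^sup>*)" "transp_on UNIV (\<subseteq>\<^sup>*)"
  unfolding reflp_on_def transp_on_def
  by (simp add: almost_subset_refl) (blast intro: almost_subset_trans)

lemma partial_order_le_mod_fin:
  "reflp_on Pow_mod_fin le_mod_fin" "transp_on Pow_mod_fin le_mod_fin"
  "antisymp_on Pow_mod_fin le_mod_fin"
proof -
  have rep: "\<exists>a. X = eq_mod_fin `` {a}" if "X \<in> Pow_mod_fin" for X
    using that by (auto simp: Pow_mod_fin_def quotient_def)
  show "reflp_on Pow_mod_fin le_mod_fin"
    unfolding reflp_on_def using rep le_mod_fin_class almost_subset_refl by metis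
  show "transp_on Pow_mod_fin le_mod_fin"
    unfolding transp_on_def using rep le_mod_fin_class almost_subset_trans by metis
  show "antisymp_on Pow_mod_fin le_mod_fin"
  proof (rule antisymp_onI)
    fix X Y
    assume "X \<in> Pow_mod_fin" "Y \<in> Pow_mod_fin" and le: "le_mod_fin X Y" "le_mod_fin Y X"
    then obtain a b where ab: "X = eq_mod_fin `` {a}" "Y = eq_mod_fin `` {b}"
      using rep by blast
    with le have "(a, b) \<in> eq_mod_fin"
      by (simp only: le_mod_fin_class eq_mod_fin_iff)
    then show "X = Y"
      unfolding ab by (rule equiv_class_eq [OF equiv_eq_mod_fin])
  qed
qed

lemma quasi_order_eventually_le: "reflp_on UNIV (\<le>\<^sup>*)" "transp_on UNIV (\<le>\<^sup>*)"
proof -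
  show "reflp_on UNIV (\<le>\<^sup>*)"
    by (simp add: reflp_on_def eventually_le_def)
  have "finite {n. \<not> f n \<le> h n}"
    if "finite {n. \<not> f n \<le> g n}" "finite {n. \<not> g n \<le> h n}" for f g h :: "nat \<Rightarrow> nat"
    by (rule finite_subset [OF _ finite_UnI [OF that]]) (auto intro: order_trans)
  then show "transp_on UNIV (\<le>\<^sup>*)"
    by (auto simp: transp_on_def eventually_le_def)
qed

lemma quasi_order_pointwise:
  "reflp_on UNIV ((\<le>) :: (nat \<Rightarrow> 'a::preorder) \<Rightarrow> _)"
  "transp_on UNIV ((\<le>) :: (nat \<Rightarrow> 'a::preorder) \<Rightarrow> _)"
  unfolding reflp_on_def transp_on_def by simp (blast intro: order_trans)

end

theory Submission
  imports Defs
begin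

text \<open>All but one of the implications come from a single transfer principle. Let \<open>i : Q \<rightarrow> P\<close> be
  monotone, and let \<open>j : P \<rightarrow> Q\<close> send every element of an interval \<open>[i p, i q]\<close> with \<open>p \<le> q\<close> into
  \<open>[p, q]\<close>. Then \<open>q \<mapsto> j ` f (i q)\<close> witnesses the weak Freese-Nation property of \<open>Q\<close> whenever \<open>f\<close>
  witnesses that of \<open>P\<close>: an interpolant between \<open>i p\<close> and \<open>i q\<close> is sent by \<open>j\<close> to one between \<open>p\<close>
  and \<open>q\<close>. Only the values of \<open>j\<close> on such intervals matter. This makes it harmless that \<open>\<nat>\<close> and \<open>\<real>\<close>
  lack suprema of unbounded sets.

  Splitting \<open>\<omega>\<close> into infinitely many infinite columns, a subset of \<open>\<omega>\<close> becomes a sequence of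
  subsets. A function into \<open>\<omega>\<close> is coded by the initial segments below its values, and a function
  into \<open>\<real>\<close> by the lower Dedekind cuts of its values; decoding takes the cardinality or the supremum
  of each column. Conversely, sets sit inside the function orders as indicator functions. A set \<open>a\<close>
  is coded for the step from \<open>\<subseteq>\<^sup>*\<close> to \<open>\<subseteq>\<close> by filling the whole column \<open>n\<close> for each \<open>n \<in> a\<close>: a set that
  is almost equal to this code on a column is there either infinite or finite, so no finite error
  can change the decoded set. Finally, taking classes and choosing representatives are the two maps
  that relate \<open>\<subseteq>\<^sup>*\<close> to its quotient order, in either direction.

  The remaining step, from \<open>\<subseteq>\<close> to \<open>\<subseteq>\<^sup>*\<close>, rests on the fact that a set has only countably many finite
  modifications, so that \<open>f\<close> may be replaced by its union over them.\<close>

section \<open>Transfer along interval-preserving maps\<close>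

lemma weak_Freese_Nation_transfer:
  assumes "weak_Freese_Nation P leP"
    and "i \<in> Q \<rightarrow> P" and "j \<in> P \<rightarrow> Q"
    and mono: "\<And>p q. p \<in> Q \<Longrightarrow> q \<in> Q \<Longrightarrow> leQ p q \<Longrightarrow> leP (i p) (i q)"
    and between: "\<And>p q r. p \<in> Q \<Longrightarrow> q \<in> Q \<Longrightarrow> r \<in> P \<Longrightarrow> leQ p q \<Longrightarrow> leP (i p) r \<Longrightarrow> leP r (i q)
                    \<Longrightarrow> leQ p (j r) \<and> leQ (j r) q"
  shows "weak_Freese_Nation Q leQ"
proof -
  obtain f where f: "f \<in> P \<rightarrow> {C. C \<subseteq> P \<and> countable C}"
    and interp: "\<forall>p\<in>P. \<forall>q\<in>P. leP p q \<longrightarrow> (\<exists>r\<in>f p \<inter> f q. leP p r \<and> leP r q)"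
    using assms(1) unfolding weak_Freese_Nation_def by blast
  have "(\<lambda>q. j ` f (i q)) \<in> Q \<rightarrow> {C. C \<subseteq> Q \<and> countable C}"
    using f assms(2,3) by (fastforce simp: Pi_iff)
  moreover have "\<exists>r\<in>j ` f (i p) \<inter> j ` f (i q). leQ p r \<and> leQ r q"
    if pq: "p \<in> Q" "q \<in> Q" "leQ p q" for p q
  proof -
    have ipq: "i p \<in> P" "i q \<in> P"
      using pq assms(2) by auto
    then obtain r where r: "r \<in> f (i p)" "r \<in> f (i q)" "leP (i p) r" "leP r (i q)"
      using interp mono[OF pq] by blast
    then have "r \<in> P"
      using f ipq by blast
    then show ?thesis
      using between[OF pq(1,2) _ pq(3)] r by blast
  qed
  ultimately show ?thesis
    unfolding weak_Freese_Nation_def by (intro bexI[of _ "\<lambda>q. j ` f (i q)"]) auto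
qed

section \<open>Splitting a set of natural numbers into columns\<close>

definition from_columns :: "(nat \<Rightarrow> nat set) \<Rightarrow> nat set" where
  "from_columns D = {prod_encode (n, m) | n m. m \<in> D n}"

definition column :: "nat set \<Rightarrow> nat \<Rightarrow> nat set" where
  "column A n = {m. prod_encode (n, m) \<in> A}"

lemma column_from_columns [simp]: "column (from_columns D) n = D n"
  by (auto simp: column_def from_columns_def)

lemma mem_iff_column: "x \<in> A \<longleftrightarrow> snd (prod_decode x) \<in> column A (fst (prod_decode x))"
  by (simp add: column_def)

lemma from_columns_subset_iff: "from_columns D \<subseteq> A \<longleftrightarrow> (\<forall>n. D n \<subseteq> column A n)"
  by (auto simp: from_columns_def column_def)

lemma subset_from_columns_iff: "A \<subseteq> from_columns D \<longleftrightarrow> (\<forall>n. column A n \<subseteq> D n)"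
proof
  assume *: "\<forall>n. column A n \<subseteq> D n"
  show "A \<subseteq> from_columns D"
  proof
    fix x assume "x \<in> A"
    with * show "x \<in> from_columns D"
      unfolding mem_iff_column[of x] column_from_columns by blast
  qed
qed (auto simp: from_columns_def column_def)

text \<open>A set of pairs is finite iff it meets finitely many columns, each in a finite set. Both halves
  of the condition matter for the decodings: the first one controls every single column, the second
  one makes almost all columns free of error.\<close>

lemma almost_subset_iff_columns:
  "A \<subseteq>\<^sup>* B \<longleftrightarrow> (\<forall>n. finite (column A n - column B n)) \<and> finite {n. \<not> column A n \<subseteq> column B n}"
  (is "_ \<longleftrightarrow> ?cols \<and> finite ?bad")
proof
  assume "A \<subseteq>\<^sup>* B"
  then have fin: "finite (prod_decode ` (A - B))"
    by (simp add: almost_subset_def)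
  have mem: "(n, m) \<in> prod_decode ` (A - B)" if "m \<in> column A n - column B n" for n m
    using that by (auto simp: column_def image_iff intro!: bexI[of _ "prod_encode (n, m)"])
  have "finite (column A n - column B n)" for n
  proof (rule finite_subset[OF _ finite_imageI[OF fin, of snd]], rule)
    show "m \<in> snd ` prod_decode ` (A - B)" if "m \<in> column A n - column B n" for m
      using imageI[OF mem[OF that], of snd] by simp
  qed
  moreover have "?bad \<subseteq> fst ` prod_decode ` (A - B)"
  proof
    fix n assume "n \<in> ?bad"
    then obtain m where "m \<in> column A n - column B n"
      by blast
    then show "n \<in> fst ` prod_decode ` (A - B)"
      using imageI[OF mem, of m n fst] by simp
  qed
  ultimately show "?cols \<and> finite ?bad"
    using finite_subset[OF _ finite_imageI[OF fin, of fst]] by (simp add: almost_subset_def)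
next
  assume *: "?cols \<and> finite ?bad"
  have "A - B \<subseteq> prod_encode ` (SIGMA n : ?bad. column A n - column B n)"
  proof
    fix x assume x: "x \<in> A - B"
    obtain n m where nm: "x = prod_encode (n, m)"
      by (metis prod_decode_inverse surj_pair)
    with x have "m \<in> column A n - column B n"
      by (simp add: column_def)
    then show "x \<in> prod_encode ` (SIGMA n : ?bad. column A n - column B n)"
      unfolding nm by (intro imageI) blast
  qed
  moreover have "finite (prod_encode ` (SIGMA n : ?bad. column A n - column B n))"
    using * by (intro finite_imageI finite_SigmaI) (auto simp: almost_subset_def)
  ultimately show "A \<subseteq>\<^sup>* B"
    unfolding almost_subset_def by (rule finite_subset)
qed

section \<open>Inclusion and almost inclusion\<close>

lemma countable_finite_modifications: "countable {b. finite ((a - b) \<union> (b - a))}"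
  for a :: "nat set"
proof (rule countable_subset)
  show "{b. finite ((a - b) \<union> (b - a))} \<subseteq> (\<lambda>c. (a - c) \<union> (c - a)) ` {c. finite c}"
  proof
    fix b assume "b \<in> {b. finite ((a - b) \<union> (b - a))}"
    then show "b \<in> (\<lambda>c. (a - c) \<union> (c - a)) ` {c. finite c}"
      by (intro image_eqI[of _ _ "(a - b) \<union> (b - a)"]) auto
  qed
  show "countable ((\<lambda>c. (a - c) \<union> (c - a)) ` {c. finite c})"
    using countable_Collect_finite by (rule countable_image)
qed

text \<open>If \<open>a \<subseteq>\<^sup>* b\<close> then \<open>a \<inter> b\<close> is a finite modification of \<open>a\<close>, and a set interpolating between
  \<open>a \<inter> b\<close> and \<open>b\<close> interpolates between \<open>a\<close> and \<open>b\<close> up to a finite error.\<close>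

lemma weak_Freese_Nation_almost_subset_if_subset:
  assumes "weak_Freese_Nation (UNIV :: nat set set) (\<subseteq>)"
  shows "weak_Freese_Nation UNIV (\<subseteq>\<^sup>*)"
proof -
  obtain f :: "nat set \<Rightarrow> nat set set" where count: "\<And>a. countable (f a)"
    and interp: "\<And>a b. a \<subseteq> b \<Longrightarrow> \<exists>r\<in>f a \<inter> f b. a \<subseteq> r \<and> r \<subseteq> b"
    using assms unfolding weak_Freese_Nation_def by (auto simp: Pi_iff)
  define g where "g a = (\<Union>b\<in>{b. finite ((a - b) \<union> (b - a))}. f b)" for a
  have "countable (g a)" for a
    unfolding g_def using count countable_finite_modifications by blast
  moreover have "\<exists>r\<in>g a \<inter> g b. a \<subseteq>\<^sup>* r \<and> r \<subseteq>\<^sup>* b" if "a \<subseteq>\<^sup>* b" for a b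
  proof -
    obtain r where r: "r \<in> f (a \<inter> b)" "r \<in> f b" "a \<inter> b \<subseteq> r" "r \<subseteq> b"
      using interp[of "a \<inter> b" b] by blast
    have fin: "finite (a - b)"
      using that by (simp add: almost_subset_def)
    have "finite ((a - a \<inter> b) \<union> (a \<inter> b - a))"
      by (rule finite_subset[OF _ fin]) auto
    then have "r \<in> g a"
      unfolding g_def using r(1) by blast
    moreover have "r \<in> g b"
      unfolding g_def using r(2) by (intro UN_I[of b]) auto
    moreover have "finite (a - r)"
      by (rule finite_subset[OF _ fin]) (use r(3) in auto)
    moreover have "finite (r - b)"
      using r(4) by (simp add: Diff_eq_empty_iff[THEN iffD2])
    ultimately show ?thesis
      unfolding almost_subset_def by blast
  qed
  ultimately show ?thesis
    unfolding weak_Freese_Nation_def by (intro bexI[of _ g]) auto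
qed

text \<open>A set between the codes of \<open>a\<close> and \<open>b\<close> modulo finite has cofinite columns over \<open>a\<close> and finite
  ones outside \<open>b\<close>, so the positions of its infinite columns form a set between \<open>a\<close> and \<open>b\<close>.\<close>

lemma weak_Freese_Nation_subset_if_almost_subset:
  assumes "weak_Freese_Nation UNIV (\<subseteq>\<^sup>*)"
  shows "weak_Freese_Nation (UNIV :: nat set set) (\<subseteq>)"
proof (rule weak_Freese_Nation_transfer[OF assms,
      where i = "\<lambda>a. from_columns (\<lambda>n. if n \<in> a then UNIV else {})"
        and j = "\<lambda>r. {n. infinite (column r n)}"])
  fix a b r :: "nat set"
  let ?i = "\<lambda>a. from_columns (\<lambda>n. if n \<in> a then UNIV else {})"
  {
    assume "a \<subseteq> b"
    then show "?i a \<subseteq>\<^sup>* ?i b"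
      unfolding almost_subset_iff_columns column_from_columns by (simp add: subset_iff)
  }
  assume "?i a \<subseteq>\<^sup>* r" "r \<subseteq>\<^sup>* ?i b"
  then have *: "finite ((if n \<in> a then UNIV else {}) - column r n)"
    "finite (column r n - (if n \<in> b then UNIV else {}))" for n
    unfolding almost_subset_iff_columns column_from_columns by blast+
  have "infinite (column r n)" if "n \<in> a" for n
    using *(1)[of n] that by (auto dest: finite_Diff2)
  moreover have "n \<in> b" if "infinite (column r n)" for n
    using *(2)[of n] that by (auto split: if_splits)
  ultimately show "a \<subseteq> {n. infinite (column r n)} \<and> {n. infinite (column r n)} \<subseteq> b"
    by blast
qed auto

section \<open>Almost inclusion and the quotient modulo finite sets\<close>

lemma class_in_Pow_mod_fin: "eq_mod_fin `` {a} \<in> Pow_mod_fin"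
  by (simp add: Pow_mod_fin_def quotientI)

lemma class_of_representative:
  assumes "X \<in> Pow_mod_fin"
  shows "eq_mod_fin `` {SOME a. a \<in> X} = X"
proof -
  obtain a where X: "X = eq_mod_fin `` {a}"
    using assms by (auto simp: Pow_mod_fin_def quotient_def)
  then have "a \<in> X"
    by (simp add: eq_mod_fin_iff almost_subset_refl)
  then have "(SOME a. a \<in> X) \<in> X"
    by (rule someI)
  then have "(a, SOME a. a \<in> X) \<in> eq_mod_fin"
    by (simp only: X Image_singleton_iff)
  then show ?thesis
    unfolding X by (rule equiv_class_eq[OF equiv_eq_mod_fin, symmetric])
qed

lemma weak_Freese_Nation_almost_subset_iff_mod_fin:
  "weak_Freese_Nation UNIV (\<subseteq>\<^sup>*) \<longleftrightarrow> weak_Freese_Nation Pow_mod_fin le_mod_fin"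
proof
  have rep: "(SOME a. a \<in> X) \<subseteq>\<^sup>* b \<longleftrightarrow> le_mod_fin X (eq_mod_fin `` {b})"
    "b \<subseteq>\<^sup>* (SOME a. a \<in> X) \<longleftrightarrow> le_mod_fin (eq_mod_fin `` {b}) X"
    if "X \<in> Pow_mod_fin" for X b
    using le_mod_fin_class class_of_representative[OF that] by metis+
  show "weak_Freese_Nation Pow_mod_fin le_mod_fin" if "weak_Freese_Nation UNIV (\<subseteq>\<^sup>*)"
    by (rule weak_Freese_Nation_transfer[OF that,
          where i = "\<lambda>X. SOME a. a \<in> X" and j = "\<lambda>a. eq_mod_fin `` {a}"])
      (auto simp: rep class_of_representative class_in_Pow_mod_fin)
  show "weak_Freese_Nation UNIV (\<subseteq>\<^sup>*)" if "weak_Freese_Nation Pow_mod_fin le_mod_fin"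
    by (rule weak_Freese_Nation_transfer[OF that,
          where i = "\<lambda>a. eq_mod_fin `` {a}" and j = "\<lambda>X. SOME a. a \<in> X"])
      (auto simp: rep le_mod_fin_class class_in_Pow_mod_fin)
qed

section \<open>Almost inclusion and eventual domination\<close>

text \<open>Counting recovers \<open>k\<close> from \<open>{..<k}\<close> and is monotone on finite sets, hence it also decodes
  sets that lie between two initial segments without being one.\<close>

lemma between_initial_segments:
  assumes "{..<k} \<subseteq> S" "S \<subseteq> {..<l}"
  shows "k \<le> card S \<and> card S \<le> l"
proof
  have "finite S"
    using assms(2) by (rule finite_subset) simp
  then show "k \<le> card S"
    using card_mono[OF _ assms(1)] by simp
  show "card S \<le> l"
    using card_mono[OF _ assms(2)] by simp
qed

lemma weak_Freese_Nation_eventually_le_iff_almost_subset: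
  "weak_Freese_Nation UNIV (\<le>\<^sup>*) \<longleftrightarrow> weak_Freese_Nation UNIV (\<subseteq>\<^sup>*)"
proof
  assume wFN: "weak_Freese_Nation UNIV (\<le>\<^sup>*)"
  show "weak_Freese_Nation UNIV (\<subseteq>\<^sup>*)"
  proof (rule weak_Freese_Nation_transfer[OF wFN,
        where i = "\<lambda>a n. of_bool (n \<in> a)" and j = "\<lambda>h. {n. 0 < h n}"])
    fix a b :: "nat set" and h :: "nat \<Rightarrow> nat"
    show "(\<lambda>n. of_bool (n \<in> a)) \<le>\<^sup>* (\<lambda>n. of_bool (n \<in> b))" if "a \<subseteq>\<^sup>* b"
      using that unfolding almost_subset_def eventually_le_def
      by (rule finite_subset[rotated]) auto
    assume "(\<lambda>n. of_bool (n \<in> a)) \<le>\<^sup>* h" "h \<le>\<^sup>* (\<lambda>n. of_bool (n \<in> b))"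
    then have fin: "finite {n. \<not> of_bool (n \<in> a) \<le> h n}" "finite {n. \<not> h n \<le> of_bool (n \<in> b)}"
      by (simp_all add: eventually_le_def)
    have "finite (a - {n. 0 < h n})"
      by (rule finite_subset[OF _ fin(1)]) auto
    moreover have "finite ({n. 0 < h n} - b)"
      by (rule finite_subset[OF _ fin(2)]) auto
    ultimately show "a \<subseteq>\<^sup>* {n. 0 < h n} \<and> {n. 0 < h n} \<subseteq>\<^sup>* b"
      by (simp add: almost_subset_def)
  qed auto
next
  assume wFN: "weak_Freese_Nation UNIV (\<subseteq>\<^sup>*)"
  show "weak_Freese_Nation UNIV (\<le>\<^sup>*)"
  proof (rule weak_Freese_Nation_transfer[OF wFN,
        where i = "\<lambda>f. from_columns (\<lambda>n. {..<f n})" and j = "\<lambda>r n. card (column r n)"])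
    fix f g :: "nat \<Rightarrow> nat" and r :: "nat set"
    show "from_columns (\<lambda>n. {..<f n}) \<subseteq>\<^sup>* from_columns (\<lambda>n. {..<g n})" if "f \<le>\<^sup>* g"
      using that unfolding almost_subset_iff_columns column_from_columns eventually_le_def
      by simp
    assume "from_columns (\<lambda>n. {..<f n}) \<subseteq>\<^sup>* r" "r \<subseteq>\<^sup>* from_columns (\<lambda>n. {..<g n})"
    then have "finite ({n. \<not> {..<f n} \<subseteq> column r n} \<union> {n. \<not> column r n \<subseteq> {..<g n}})" (is "finite ?bad")
      unfolding almost_subset_iff_columns column_from_columns by blast
    moreover have "f n \<le> card (column r n) \<and> card (column r n) \<le> g n" if "n \<notin> ?bad" for n
      using that by (intro between_initial_segments) auto
    then have "{n. \<not> f n \<le> card (column r n)} \<subseteq> ?bad" "{n. \<not> card (column r n) \<le> g n} \<subseteq> ?bad"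
      by blast+
    ultimately show "f \<le>\<^sup>* (\<lambda>n. card (column r n)) \<and> (\<lambda>n. card (column r n)) \<le>\<^sup>* g"
      unfolding eventually_le_def by (blast intro: finite_subset)
  qed auto
qed

section \<open>Inclusion and pointwise domination\<close>

lemma weak_Freese_Nation_subset_if_nat_le:
  assumes "weak_Freese_Nation (UNIV :: (nat \<Rightarrow> nat) set) (\<le>)"
  shows "weak_Freese_Nation (UNIV :: nat set set) (\<subseteq>)"
proof (rule weak_Freese_Nation_transfer[OF assms,
      where i = "\<lambda>a n. of_bool (n \<in> a)" and j = "\<lambda>h. {n. 0 < h n}"])
  fix a b :: "nat set" and h :: "nat \<Rightarrow> nat"
  assume "(\<lambda>n. of_bool (n \<in> a)) \<le> h" "h \<le> (\<lambda>n. of_bool (n \<in> b))"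
  then have *: "of_bool (n \<in> a) \<le> h n" "h n \<le> of_bool (n \<in> b)" for n
    by (simp_all add: le_fun_def)
  have "0 < h n" if "n \<in> a" for n
    using *(1)[of n] that by simp
  moreover have "n \<in> b" if "0 < h n" for n
    using *(2)[of n] that by (cases "n \<in> b") auto
  ultimately show "a \<subseteq> {n. 0 < h n} \<and> {n. 0 < h n} \<subseteq> b"
    by blast
qed (auto simp: le_fun_def)

text \<open>Rounding down preserves the integer bounds of an interval between two integer-valued
  functions.\<close>

lemma weak_Freese_Nation_nat_le_if_real_le:
  assumes "weak_Freese_Nation (UNIV :: (nat \<Rightarrow> real) set) (\<le>)"
  shows "weak_Freese_Nation (UNIV :: (nat \<Rightarrow> nat) set) (\<le>)"
proof (rule weak_Freese_Nation_transfer[OF assms,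
      where i = "\<lambda>f n. real (f n)" and j = "\<lambda>h n. nat \<lfloor>h n\<rfloor>"])
  fix f g :: "nat \<Rightarrow> nat" and h :: "nat \<Rightarrow> real"
  assume "(\<lambda>n. real (f n)) \<le> h" "h \<le> (\<lambda>n. real (g n))"
  then have "f n \<le> nat \<lfloor>h n\<rfloor> \<and> nat \<lfloor>h n\<rfloor> \<le> g n" for n
    using le_nat_floor[of "f n" "h n"] floor_mono[of "h n" "real (g n)"] by (simp add: le_fun_def)
  then show "f \<le> (\<lambda>n. nat \<lfloor>h n\<rfloor>) \<and> (\<lambda>n. nat \<lfloor>h n\<rfloor>) \<le> g"
    by (simp add: le_fun_def)
qed (auto simp: le_fun_def)

text \<open>The rational cut of \<open>x\<close> is nonempty and that of \<open>y\<close> is bounded, so every set between the two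
  has a genuine supremum; the density of the rationals puts it above \<open>x\<close>.\<close>

lemma between_rational_cuts:
  fixes x y :: real
  assumes "{q. real_of_rat q < x} \<subseteq> S" "S \<subseteq> {q. real_of_rat q < y}"
  shows "x \<le> Sup (real_of_rat ` S) \<and> Sup (real_of_rat ` S) \<le> y"
proof
  have bdd: "bdd_above (real_of_rat ` S)"
    using assms(2) by (intro bdd_aboveI2[of _ _ y]) auto
  show "x \<le> Sup (real_of_rat ` S)"
  proof (rule ccontr)
    assume "\<not> x \<le> Sup (real_of_rat ` S)"
    then obtain q where q: "Sup (real_of_rat ` S) < real_of_rat q" "real_of_rat q < x"
      using of_rat_dense by (meson not_le)
    then have "real_of_rat q \<le> Sup (real_of_rat ` S)"
      using assms(1) by (intro cSup_upper bdd) auto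
    with q(1) show False
      by simp
  qed
  obtain q where "real_of_rat q < x"
    using of_rat_dense[of "x - 1" x] by auto
  then have "real_of_rat ` S \<noteq> {}"
    using assms(1) by auto
  then show "Sup (real_of_rat ` S) \<le> y"
    using assms(2) by (intro cSup_least) (auto intro: less_imp_le)
qed

text \<open>Each column holds a set of rationals through an enumeration, so a function into \<open>\<real>\<close> becomes a
  sequence of Dedekind cuts. A column lying between two cuts need not be a cut itself, but its
  supremum lies between the two reals.\<close>

lemma weak_Freese_Nation_real_le_if_subset:
  assumes "weak_Freese_Nation (UNIV :: nat set set) (\<subseteq>)"
  shows "weak_Freese_Nation (UNIV :: (nat \<Rightarrow> real) set) (\<le>)"
proof (rule weak_Freese_Nation_transfer[OF assms,
      where i = "\<lambda>f. from_columns (\<lambda>n. to_nat ` {q. real_of_rat q < f n})"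
        and j = "\<lambda>r n. Sup (real_of_rat ` (to_nat -` column r n))"])
  fix f g :: "nat \<Rightarrow> real" and r :: "nat set"
  let ?i = "\<lambda>f. from_columns (\<lambda>n. to_nat ` {q. real_of_rat q < f n})"
  show "?i f \<subseteq> ?i g" if "f \<le> g"
    unfolding from_columns_subset_iff column_from_columns
    using that by (auto simp: le_fun_def intro!: imageI intro: less_le_trans)
  assume "?i f \<subseteq> r" "r \<subseteq> ?i g"
  then have *: "to_nat ` {q. real_of_rat q < f n} \<subseteq> column r n"
    "column r n \<subseteq> to_nat ` {q. real_of_rat q < g n}" for n
    by (simp_all add: from_columns_subset_iff subset_from_columns_iff)
  have "f n \<le> Sup (real_of_rat ` (to_nat -` column r n))
      \<and> Sup (real_of_rat ` (to_nat -` column r n)) \<le> g n" for n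
    using *[of n] by (intro between_rational_cuts) auto
  then show "f \<le> (\<lambda>n. Sup (real_of_rat ` (to_nat -` column r n)))
      \<and> (\<lambda>n. Sup (real_of_rat ` (to_nat -` column r n))) \<le> g"
    by (simp add: le_fun_def)
qed auto

section \<open>The equivalences\<close>

theorem lemma1p1:
  shows "(weak_Freese_Nation (UNIV :: nat set set) (\<subseteq>)
            \<longleftrightarrow> weak_Freese_Nation (UNIV :: nat set set) (\<subseteq>\<^sup>*))
       \<and> (weak_Freese_Nation (UNIV :: nat set set) (\<subseteq>)
            \<longleftrightarrow> weak_Freese_Nation Pow_mod_fin le_mod_fin)
       \<and> (weak_Freese_Nation (UNIV :: nat set set) (\<subseteq>)
            \<longleftrightarrow> weak_Freese_Nation (UNIV :: (nat \<Rightarrow> nat) set) (\<le>))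
       \<and> (weak_Freese_Nation (UNIV :: nat set set) (\<subseteq>)
            \<longleftrightarrow> weak_Freese_Nation (UNIV :: (nat \<Rightarrow> nat) set) (\<le>\<^sup>*))
       \<and> (weak_Freese_Nation (UNIV :: nat set set) (\<subseteq>)
            \<longleftrightarrow> weak_Freese_Nation (UNIV :: (nat \<Rightarrow> real) set) (\<le>))"
  using weak_Freese_Nation_almost_subset_if_subset weak_Freese_Nation_subset_if_almost_subset
    weak_Freese_Nation_almost_subset_iff_mod_fin weak_Freese_Nation_eventually_le_iff_almost_subset
    weak_Freese_Nation_subset_if_nat_le weak_Freese_Nation_nat_le_if_real_le
    weak_Freese_Nation_real_le_if_subset
  by blast

end
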